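(* Let $p_K^\ast$ and $p_{\hat K}^\ast$ be the optimal values of the sampled problem and of the partition-based problem, respectively, with corresponding optimal controls $U_K^\ast$ and $U_{\hat K}^\ast$. Define $$\hat p=\frac1K\sum_{i=1}^K 1_{\mathcal{R}}\left(X(x_0,U_{\hat K}^\ast,W^{(i)})\right).$$ Then $$p_{\hat K}^\ast\ \le\ \hat p\ \le\ p_K^\ast .$$
   Context: System. Consider $x_{t+1}=Ax_t+Bu_t+w_t$ with $x_t\in\mathbb{R}^{n_x}$, $u_t\in\mathcal{U}\subseteq\mathbb{R}^{n_u}$, $w_t\in\mathcal{W}\subseteq\mathbb{R}^{n_x}$. Over a horizon $N\ge1$, with $X=[x_1^\top,\dots,x_N^\top]^\top$, $U=[u_0^\top,\dots,u_{N-1}^\top]^\top\in\mathcal{U}^N$, $W=[w_0^\top,\dots,w_{N-1}^\top]^\top\in\mathcal{W}^N$, one has $X=X(x_0,U,W)=G_xx_0+G_uU+G_wW$, where the $t$-th block row reads $x_t=A^tx_0+\sum_{s=0}^{t-1}A^{t-1-s}(Bu_s+w_s)$. The safe set $\mathcal{S}$ and target set $\mathcal{T}$ are polytopes in $\mathbb{R}^{n_x}$, and $\mathcal{R}=\mathcal{S}^{N-1}\times\mathcal{T}=\{X\in\mathbb{R}^{Nn_x}:FX\le h\}$ with $F\in\mathbb{R}^{L\times Nn_x}$ (rows $F_\ell$), $h\in\mathbb{R}^L$ (componentwise inequalities). $1_{\mathcal R}$ is the indicator function of $\mathcal{R}$. The initial state $x_0\in\mathcal{S}$ and the disturbance samples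 $W^{(1)},\dots,W^{(K)}\in\mathcal{W}^N$ are given. Sampled problem. Maximize $\frac1K\sum_{i=1}^K z^{(i)}$ over $U\in\mathcal{U}^N$ and $z^{(i)}\in\{0,1\}$ subject to $X^{(i)}=G_xx_0+G_uU+G_wW^{(i)}$ and $FX^{(i)}\le h+M(1-z^{(i)})\mathbf{1}$, $i=1,\dots,K$. Partition-based problem. Maximize $\frac1K\sum_{j=1}^{\hat K}\alpha^{(j)}\hat z^{(j)}$ over $U\in\mathcal{U}^N$ and $\hat z^{(j)}\in\{0,1\}$ subject to $\hat X^{(j)}=G_xx_0+G_uU+\psi^{(j)}$ and $F\hat X^{(j)}\le h-\varepsilon^{(j)}+M(1-\hat z^{(j)})\mathbf{1}$, $j=1,\dots,\hat K$. $M>0$ is the same large constant in both problems, large enough that the constraints are inactive whenever the corresponding binary variable equals $0$ (big-M convention). Data of the partition-based problem. $\Phi_K=\{G_wW^{(1)},\dots,G_wW^{(K)}\}$, and $\Psi_{\hat K}=\{\psi^{(1)},\dots,\psi^{(\hat K)}\}\subset\mathbb{R}^{Nn_x}$ is a set of selected seeds. The $j$-th Voronoi cell is $V^{(j)}=\{p\in\Phi_K:\|p-\psi^{(j)}\|\le\|p-\psi^{(\ell)}\|\ \text{for all }\ell\ne j\}$ (Euclidean norm). The cells partition the $K$ samples: each sample (counted with its index $i$) is assigned to exactly one cell, ties being broken arbitrarily. All cells are nonempty. $\alpha^{(j)}=|V^{(j)}|$ is the number of samples in the cell, so $\sum_j\alpha^{(j)}=K$. The buffer is $\varepsilon^{(j)}=[\epsilon^{(j)}_1,\dots,\epsilon^{(j)}_L]^\top$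 with $\epsilon_\ell^{(j)}=\max_{\phi\in V^{(j)}}(F_\ell\phi-F_\ell\psi^{(j)})$. *)

theory Defs
  imports "HOL-Analysis.Analysis"
begin

text \<open>
  The horizon is a finite linearly ordered index type \<open>'h\<close> with \<open>N = CARD('h)\<close>, so \<open>N \<ge> 1\<close>.
  The index \<open>k\<close> with \<open>step k = t\<close>, \<open>t = 0, \<dots>, N - 1\<close>, labels block \<open>u\<^sub>t\<close> of a stacked control,
  block \<open>w\<^sub>t\<close> of a stacked disturbance, and block \<open>x\<close> at time \<open>t + 1\<close> of a stacked trajectory.
  A stacked vector is an element of \<open>real ^ ('h \<times> 'n)\<close>, whose norm is the Euclidean norm.
\<close>

definition step :: "'h::{finite,linorder} \<Rightarrow> nat"
  where "step k = card {j. j < k}"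

definition block :: "real ^ ('h::finite \<times> 'n::finite) \<Rightarrow> 'h \<Rightarrow> real ^ 'n"
  where "block X k = (\<chi> i. X $ (k, i))"

definition stack_power :: "(real ^ 'n::finite) set \<Rightarrow> (real ^ ('h::finite \<times> 'n)) set"
  where "stack_power D = {V. \<forall>k. block V k \<in> D}"

text \<open>The power operation of the type class hierarchy is componentwise on matrices.\<close>

definition matpow :: "real ^ 'n ^ 'n \<Rightarrow> nat \<Rightarrow> real ^ 'n ^ 'n"
  where "matpow A t = (((**) A) ^^ t) (mat 1)"

definition Gx :: "real ^ 'n ^ 'n \<Rightarrow> real ^ 'n ^ ('h::{finite,linorder} \<times> 'n::finite)"
  where "Gx A = (\<chi> p. matpow A (Suc (step (fst p))) $ snd p)"

definition Gu :: "real ^ 'n ^ 'n \<Rightarrow> real ^ 'm ^ 'n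
    \<Rightarrow> real ^ ('h \<times> 'm::finite) ^ ('h::{finite,linorder} \<times> 'n::finite)"
  where "Gu A B = (\<chi> p q. if fst q \<le> fst p
           then (matpow A (step (fst p) - step (fst q)) ** B) $ snd p $ snd q else 0)"

definition Gw :: "real ^ 'n ^ 'n \<Rightarrow> real ^ ('h \<times> 'n) ^ ('h::{finite,linorder} \<times> 'n::finite)"
  where "Gw A = (\<chi> p q. if fst q \<le> fst p
           then matpow A (step (fst p) - step (fst q)) $ snd p $ snd q else 0)"

definition traj :: "real ^ 'n ^ 'n \<Rightarrow> real ^ 'm ^ 'n \<Rightarrow> real ^ 'n
    \<Rightarrow> real ^ ('h \<times> 'm::finite) \<Rightarrow> real ^ ('h \<times> 'n) \<Rightarrow> real ^ ('h::{finite,linorder} \<times> 'n::finite)"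
  where "traj A B x0 U W = Gx A *v x0 + Gu A B *v U + Gw A *v W"

lemma block_traj:
  "block (traj A B x0 U W) k = matpow A (Suc (step k)) *v x0
     + (\<Sum>s | s \<le> k. matpow A (step k - step s) *v (B *v block U s + block W s))"
proof -
  have sumeq: "(\<Sum>q\<in>UNIV. (if fst q \<le> k then f (fst q) (snd q) else 0) * g q)
      = (\<Sum>s | s \<le> k. \<Sum>j\<in>UNIV. f s j * g (s, j))"
    for f :: "'b \<Rightarrow> 'd::finite \<Rightarrow> real" and g
  proof -
    have "(\<Sum>q\<in>UNIV. (if fst q \<le> k then f (fst q) (snd q) else 0) * g q)
        = (\<Sum>s\<in>UNIV. \<Sum>j\<in>UNIV. (if s \<le> k then f s j else 0) * g (s, j))"
      by (simp add: sum.cartesian_product case_prod_unfold flip: UNIV_Times_UNIV)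
    also have "\<dots> = (\<Sum>s\<in>UNIV. if s \<le> k then \<Sum>j\<in>UNIV. f s j * g (s, j) else 0)"
      by (intro sum.cong) auto
    finally show ?thesis by (simp add: sum.If_cases Collect_conj_eq)
  qed
  have 1: "block (Gu A B *v U) k = (\<Sum>s | s \<le> k. (matpow A (step k - step s) ** B) *v block U s)"
    using sumeq[of "\<lambda>s j. (matpow A (step k - step s) ** B) $ i $ j" "($) U" for i]
    by (simp add: vec_eq_iff block_def Gu_def matrix_vector_mult_def cong: if_cong)
  have 2: "block (Gw A *v W) k = (\<Sum>s | s \<le> k. matpow A (step k - step s) *v block W s)"
    using sumeq[of "\<lambda>s j. matpow A (step k - step s) $ i $ j" "($) W" for i]
    by (simp add: vec_eq_iff block_def Gw_def matrix_vector_mult_def cong: if_cong)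
  have 3: "block (Gx A *v x0) k = matpow A (Suc (step k)) *v x0"
    by (simp add: vec_eq_iff block_def Gx_def matrix_vector_mult_def)
  have "block (traj A B x0 U W) k
      = block (Gx A *v x0) k + block (Gu A B *v U) k + block (Gw A *v W) k"
    by (simp add: vec_eq_iff block_def traj_def)
  then show ?thesis
    unfolding 1 2 3
    by (simp add: matrix_vector_right_distrib sum.distrib matrix_vector_mul_assoc)
qed

definition safe_target :: "(real ^ 'n) set \<Rightarrow> (real ^ 'n) set
    \<Rightarrow> (real ^ ('h::{finite,linorder} \<times> 'n::finite)) set"
  where "safe_target S T = {X. \<forall>k. block X k \<in> (if k = Max UNIV then T else S)}"

definition sampled_feasible :: "real ^ 'n ^ 'n \<Rightarrow> real ^ 'm ^ 'n \<Rightarrow> (real ^ 'm) set \<Rightarrow> real ^ 'n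
    \<Rightarrow> real ^ ('h \<times> 'n) ^ 'l \<Rightarrow> real ^ 'l \<Rightarrow> real \<Rightarrow> nat \<Rightarrow> (nat \<Rightarrow> real ^ ('h \<times> 'n))
    \<Rightarrow> ((real ^ ('h::{finite,linorder} \<times> 'm::finite)) \<times> (nat \<Rightarrow> real)) set"
  where "sampled_feasible A B \<U> x0 F h M K W =
    {(U, z). U \<in> stack_power \<U> \<and>
       (\<forall>i\<in>{1..K}. z i \<in> {0, 1} \<and> F *v traj A B x0 U (W i) \<le> h + (M * (1 - z i)) *\<^sub>R 1)}"

definition sampled_objective :: "nat \<Rightarrow> 'u \<times> (nat \<Rightarrow> real) \<Rightarrow> real"
  where "sampled_objective K = (\<lambda>(U, z). (1 / real K) * (\<Sum>i=1..K. z i))"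

definition voronoi :: "(real ^ 'd) set \<Rightarrow> nat \<Rightarrow> (nat \<Rightarrow> real ^ 'd::finite) \<Rightarrow> nat \<Rightarrow> (real ^ 'd) set"
  where "voronoi \<Phi> Kh \<psi> j =
    {p \<in> \<Phi>. \<forall>l\<in>{1..Kh}. l \<noteq> j \<longrightarrow> norm (p - \<psi> j) \<le> norm (p - \<psi> l)}"

text \<open>
  A tie-breaking assignment \<open>c\<close> of the sample indices \<open>1, \<dots>, K\<close> (samples \<open>\<phi> i\<close>) to the
  cells \<open>1, \<dots>, Kh\<close>, each of which receives at least one sample.
\<close>

definition voronoi_assignment ::
    "nat \<Rightarrow> (nat \<Rightarrow> real ^ 'd) \<Rightarrow> nat \<Rightarrow> (nat \<Rightarrow> real ^ 'd::finite) \<Rightarrow> (nat \<Rightarrow> nat) \<Rightarrow> bool"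
  where "voronoi_assignment K \<phi> Kh \<psi> c \<longleftrightarrow>
    (\<forall>i\<in>{1..K}. c i \<in> {1..Kh} \<and> \<phi> i \<in> voronoi (\<phi> ` {1..K}) Kh \<psi> (c i)) \<and>
    (\<forall>j\<in>{1..Kh}. \<exists>i\<in>{1..K}. c i = j)"

definition cell :: "nat \<Rightarrow> (nat \<Rightarrow> nat) \<Rightarrow> nat \<Rightarrow> nat set"
  where "cell K c j = {i \<in> {1..K}. c i = j}"

definition buffer :: "real ^ 'd ^ 'l \<Rightarrow> nat \<Rightarrow> (nat \<Rightarrow> real ^ 'd) \<Rightarrow> (nat \<Rightarrow> real ^ 'd::finite)
    \<Rightarrow> (nat \<Rightarrow> nat) \<Rightarrow> nat \<Rightarrow> real ^ 'l"
  where "buffer F K \<phi> \<psi> c j =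
    (\<chi> l. Max ((\<lambda>i. (F *v \<phi> i) $ l - (F *v \<psi> j) $ l) ` cell K c j))"

definition seed_traj :: "real ^ 'n ^ 'n \<Rightarrow> real ^ 'm ^ 'n \<Rightarrow> real ^ 'n
    \<Rightarrow> real ^ ('h \<times> 'm::finite) \<Rightarrow> real ^ ('h \<times> 'n) \<Rightarrow> real ^ ('h::{finite,linorder} \<times> 'n::finite)"
  where "seed_traj A B x0 U \<psi> = Gx A *v x0 + Gu A B *v U + \<psi>"

definition partition_feasible :: "real ^ 'n ^ 'n \<Rightarrow> real ^ 'm ^ 'n \<Rightarrow> (real ^ 'm) set \<Rightarrow> real ^ 'n
    \<Rightarrow> real ^ ('h \<times> 'n) ^ 'l \<Rightarrow> real ^ 'l \<Rightarrow> real \<Rightarrow> nat \<Rightarrow> (nat \<Rightarrow> real ^ ('h \<times> 'n))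
    \<Rightarrow> (nat \<Rightarrow> real ^ 'l)
    \<Rightarrow> ((real ^ ('h::{finite,linorder} \<times> 'm::finite)) \<times> (nat \<Rightarrow> real)) set"
  where "partition_feasible A B \<U> x0 F h M Kh \<psi> \<epsilon> =
    {(U, z). U \<in> stack_power \<U> \<and>
       (\<forall>j\<in>{1..Kh}. z j \<in> {0, 1} \<and>
          F *v seed_traj A B x0 U (\<psi> j) \<le> h - \<epsilon> j + (M * (1 - z j)) *\<^sub>R 1)}"

definition partition_objective :: "nat \<Rightarrow> nat \<Rightarrow> (nat \<Rightarrow> nat) \<Rightarrow> 'u \<times> (nat \<Rightarrow> real) \<Rightarrow> real"
  where "partition_objective K Kh c =
    (\<lambda>(U, z). (1 / real K) * (\<Sum>j=1..Kh. real (card (cell K c j)) * z j))"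

definition optimal_value :: "('s \<Rightarrow> real) \<Rightarrow> 's set \<Rightarrow> real"
  where "optimal_value f D = (SUP s\<in>D. f s)"

definition optimal_control :: "('u \<times> 'z \<Rightarrow> real) \<Rightarrow> ('u \<times> 'z) set \<Rightarrow> 'u \<Rightarrow> bool"
  where "optimal_control f D U \<longleftrightarrow> (\<exists>z. is_arg_max f (\<lambda>s. s \<in> D) (U, z))"

end

theory Submission
  imports Defs
begin

text \<open>
  The buffer of a cell absorbs the deviation of every sample in it from the seed, so a control
  that satisfies the constraint of the seed satisfies the constraints of all samples in the cell.
  Hence each cell with \<open>z = 1\<close> contributes all of its samples to the empirical success count.
  Conversely, the control together with the indicators of its successful samples is feasible for
  the sampled problem.
\<close>

text \<open>A real \<open>SUP\<close> is only informative for a nonempty set that is bounded above.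
  A maximizer supplies both, so the supremum is attained there.\<close>

lemma optimal_value_arg_max:
  assumes "is_arg_max f (\<lambda>s. s \<in> D) s"
  shows "optimal_value f D = f s"
  using assms unfolding optimal_value_def is_arg_max_def
  by (intro cSup_eq_maximum) (auto simp: not_less)

text \<open>Puts samples and seeds on the same footing, so that the two kinds of constraints differ
  only in the last argument of \<open>seed_traj\<close>.\<close>

lemma traj_eq_seed_traj: "traj A B x0 U W = seed_traj A B x0 U (Gw A *v W)"
  by (simp add: traj_def seed_traj_def)

lemma seed_traj_diff: "seed_traj A B x0 U \<phi> = seed_traj A B x0 U \<psi> + (\<phi> - \<psi>)"
  by (simp add: seed_traj_def)

text \<open>By linearity of \<open>F\<close>, each entry on the left is one of the finitely many
  numbers whose \<open>Max\<close> is the corresponding buffer entry.\<close>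

lemma mult_diff_le_buffer:
  assumes "i \<in> cell K c j"
  shows "F *v (\<phi> i - \<psi> j) \<le> buffer F K \<phi> \<psi> c j"
  using assms
  by (auto simp: less_eq_vec_def buffer_def cell_def matrix_vector_mult_diff_distrib intro!: Max_ge)

lemma buffered_seed_constraint:
  assumes "F *v seed_traj A B x0 U (\<psi> j) \<le> h - buffer F K \<phi> \<psi> c j"
    and "i \<in> cell K c j"
  shows "F *v seed_traj A B x0 U (\<phi> i) \<le> h"
proof -
  have "F *v seed_traj A B x0 U (\<phi> i) = F *v seed_traj A B x0 U (\<psi> j) + F *v (\<phi> i - \<psi> j)"
    by (metis seed_traj_diff matrix_vector_right_distrib)
  also have "\<dots> \<le> (h - buffer F K \<phi> \<psi> c j) + buffer F K \<phi> \<psi> c j"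
    by (intro add_mono assms(1) mult_diff_le_buffer assms(2))
  finally show ?thesis by simp
qed

text \<open>Double counting: the cells are the fibres of \<open>c\<close>, and on the fibre over
  \<open>j\<close> the summand \<open>z (c i)\<close> is constantly \<open>z j\<close>.\<close>

lemma sum_card_cell:
  fixes z :: "nat \<Rightarrow> real"
  assumes "\<And>i. i \<in> {1..K} \<Longrightarrow> c i \<in> {1..Kh}"
  shows "(\<Sum>j=1..Kh. real (card (cell K c j)) * z j) = (\<Sum>i=1..K. z (c i))"
proof -
  have "(\<Sum>i=1..K. z (c i)) = (\<Sum>j=1..Kh. \<Sum>i\<in>cell K c j. z (c i))"
    unfolding cell_def using assms by (intro sum.group[symmetric]) auto
  also have "\<dots> = (\<Sum>j=1..Kh. real (card (cell K c j)) * z j)"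
    by (simp add: cell_def)
  finally show ?thesis by simp
qed

theorem theorem3:
  fixes A :: "real ^ 'n ^ 'n" and B :: "real ^ 'm ^ 'n"
    and \<U> :: "(real ^ 'm) set" and \<W> \<S> \<T> :: "(real ^ 'n) set"
    and x0 :: "real ^ 'n"
    and F :: "real ^ ('h::{finite,linorder} \<times> 'n) ^ 'l" and h :: "real ^ 'l"
    and M :: real and K Kh :: nat
    and W :: "nat \<Rightarrow> real ^ ('h \<times> 'n)" and \<phi> \<psi> :: "nat \<Rightarrow> real ^ ('h \<times> 'n)"
    and c :: "nat \<Rightarrow> nat" and \<epsilon> :: "nat \<Rightarrow> real ^ 'l"
    and UK UKh :: "real ^ ('h \<times> 'm)" and phat :: real
  assumes "polytope \<S>" and "polytope \<T>"
    and "safe_target \<S> \<T> = {X. F *v X \<le> h}"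
    and "x0 \<in> \<S>"
    and "K \<ge> 1" and "\<And>i. i \<in> {1..K} \<Longrightarrow> W i \<in> stack_power \<W>"
    and "\<And>i. \<phi> i = Gw A *v W i"
    and "voronoi_assignment K \<phi> Kh \<psi> c"
    and "\<And>j. \<epsilon> j = buffer F K \<phi> \<psi> c j"
    and "M > 0"
    and "\<And>U i. U \<in> stack_power \<U> \<Longrightarrow> i \<in> {1..K} \<Longrightarrow>
           F *v traj A B x0 U (W i) \<le> h + M *\<^sub>R 1"
    and "\<And>U j. U \<in> stack_power \<U> \<Longrightarrow> j \<in> {1..Kh} \<Longrightarrow>
           F *v seed_traj A B x0 U (\<psi> j) \<le> h - \<epsilon> j + M *\<^sub>R 1"
    and "optimal_control (sampled_objective K)
           (sampled_feasible A B \<U> x0 F h M K W) UK"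
    and "optimal_control (partition_objective K Kh c)
           (partition_feasible A B \<U> x0 F h M Kh \<psi> \<epsilon>) UKh"
    and "phat = (1 / real K) * (\<Sum>i=1..K. indicator (safe_target \<S> \<T>) (traj A B x0 UKh (W i)))"
  shows "optimal_value (partition_objective K Kh c)
           (partition_feasible A B \<U> x0 F h M Kh \<psi> \<epsilon>) \<le> phat
    \<and> phat \<le> optimal_value (sampled_objective K)
           (sampled_feasible A B \<U> x0 F h M K W)"
proof
  let ?R = "safe_target \<S> \<T> :: (real ^ ('h \<times> 'n)) set"
  let ?X = "\<lambda>i. traj A B x0 UKh (W i)"
  note R = assms(3) and \<phi> = assms(7) and \<epsilon> = assms(9) and bigM = assms(11)
    and phat = assms(15)
  have c: "c i \<in> {1..Kh}" if "i \<in> {1..K}" for i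
    using assms(8) that by (auto simp: voronoi_assignment_def)
  obtain z where z: "is_arg_max (partition_objective K Kh c)
      (\<lambda>s. s \<in> partition_feasible A B \<U> x0 F h M Kh \<psi> \<epsilon>) (UKh, z)"
    using assms(14) by (auto simp: optimal_control_def)
  then have feas: "(UKh, z) \<in> partition_feasible A B \<U> x0 F h M Kh \<psi> \<epsilon>"
    by (simp add: is_arg_max_def)
  then have z01: "z j \<in> {0, 1}"
      and seed: "F *v seed_traj A B x0 UKh (\<psi> j) \<le> h - \<epsilon> j + (M * (1 - z j)) *\<^sub>R 1"
    if "j \<in> {1..Kh}" for j
    using that unfolding partition_feasible_def by auto
  \<comment> \<open>Each sample is credited with the binary variable of its cell. Only an inequality
    can be expected, since a cell with value 0 may still contain successful samples.\<close>
  have z_le: "z (c i) \<le> indicator ?R (?X i)" if i: "i \<in> {1..K}" for i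
  proof (cases "z (c i) = 1")
    case True
    \<comment> \<open>At value 1 the big-M term vanishes and the tightened constraint of the seed
      remains.\<close>
    then have "F *v seed_traj A B x0 UKh (\<psi> (c i)) \<le> h - buffer F K \<phi> \<psi> c (c i)"
      using seed[OF c[OF i]] by (simp add: \<epsilon>)
    then have "F *v seed_traj A B x0 UKh (\<phi> i) \<le> h"
      by (rule buffered_seed_constraint) (use i in \<open>simp add: cell_def\<close>)
    then show ?thesis
      by (simp add: True R \<phi> traj_eq_seed_traj)
  next
    case False
    then have "z (c i) = 0"
      using z01[OF c[OF i]] by simp
    then show ?thesis by simp
  qed
  \<comment> \<open>Rewriting the weighted sum over cells as a sum over samples allows a termwise
    comparison with \<open>phat\<close>.\<close>
  have "(\<Sum>j=1..Kh. real (card (cell K c j)) * z j) = (\<Sum>i=1..K. z (c i))"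
    by (rule sum_card_cell) (rule c)
  also have "\<dots> \<le> (\<Sum>i=1..K. indicator ?R (?X i))"
    by (intro sum_mono z_le)
  finally show "optimal_value (partition_objective K Kh c)
      (partition_feasible A B \<U> x0 F h M Kh \<psi> \<epsilon>) \<le> phat"
    unfolding optimal_value_arg_max[OF z] phat
    by (simp add: partition_objective_def divide_right_mono)

  obtain z' where z': "is_arg_max (sampled_objective K)
      (\<lambda>s. s \<in> sampled_feasible A B \<U> x0 F h M K W) (UK, z')"
    using assms(13) by (auto simp: optimal_control_def)
  let ?s = "(UKh, \<lambda>i. indicator ?R (?X i))"
  have "UKh \<in> stack_power \<U>"
    using feas by (simp add: partition_feasible_def)
  \<comment> \<open>Where the indicator is 1, the constraint is membership in \<open>?R\<close>;
    where it is 0, the slack \<open>M\<close> suffices by \<open>bigM\<close>, as \<open>UKh\<close>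
    is an admissible control.\<close>
  then have "?s \<in> sampled_feasible A B \<U> x0 F h M K W"
    using bigM by (auto simp: sampled_feasible_def R indicator_def)
  \<comment> \<open>The objective at \<open>?s\<close> is exactly \<open>phat\<close>, so optimality
    of \<open>(UK, z')\<close> gives the upper bound.\<close>
  then have "sampled_objective K ?s \<le> sampled_objective K (UK, z')"
    using z' by (auto simp: is_arg_max_def not_less)
  then show "phat \<le> optimal_value (sampled_objective K) (sampled_feasible A B \<U> x0 F h M K W)"
    unfolding optimal_value_arg_max[OF z'] phat
    by (simp add: sampled_objective_def)
qed

end
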